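(* Let $V$ be a Banach space, let $k:(X,\mathcal{A},p)\to(Y,\mathcal{B},q)$ be a measure-preserving Markov kernel, and let $n$ be a positive integer or $n=\infty$. For $g\in L^n(Y,\mathcal{B},q;V)$, the Bochner integral $x\mapsto k^*g(x):=\int_Y g(y)\,k(dy\mid x)$ is defined for $p$-a.a. $x$ and gives a well-defined element of $L^n(X,\mathcal{A},p;V)$. Moreover $k^*:L^n(Y,\mathcal{B},q;V)\to L^n(X,\mathcal{A},p;V)$ is linear and 1-Lipschitz, making $L^n(-;V)$ a functor $\mathsf{GKrn}^{\mathrm{op}}\to\mathsf{Ban}$.
   Context: Markov kernels, measure-preservation, and $\mathsf{GKrn}$ (probability spaces with a.s.-classes of measure-preserving kernels, composition $(\ell\circ k)(C\mid x)=\int\ell(C\mid y)k(dy\mid x)$) as usual. A function $f:X\to V$ is strongly measurable if it is Borel measurable with separable image. For finite $n$, $L^n(X,\mathcal{A},p;V)$ is the Banach space of a.s. classes of a.s. strongly measurable $f$ with $\int_X\|f(x)\|_V^n\,p(dx)<\infty$, with norm $(\int\|f\|_V^n\,dp)^{1/n}$; $L^\infty(X,\mathcal{A},p;V)$ is the space of a.s. classes of a.s. strongly measurable, essentially bounded $f$ with the essential supremum norm. Integrals of $V$-valued functions are Bochner integrals. *)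

theory Defs
  imports "HOL-Probability.Probability"
begin

definition separable_set :: "'v::metric_space set \<Rightarrow> bool" where
  "separable_set S \<longleftrightarrow> (\<exists>D. countable D \<and> D \<subseteq> S \<and> S \<subseteq> closure D)"

definition strongly_measurable :: "'a measure \<Rightarrow> ('a \<Rightarrow> 'v::real_normed_vector) \<Rightarrow> bool" where
  "strongly_measurable M f \<longleftrightarrow> f \<in> borel_measurable M \<and> separable_set (f ` space M)"

definition ae_strongly_measurable :: "'a measure \<Rightarrow> ('a \<Rightarrow> 'v::real_normed_vector) \<Rightarrow> bool" where
  "ae_strongly_measurable M f \<longleftrightarrow> (\<exists>g. strongly_measurable M g \<and> (AE x in M. f x = g x))"

definition Lnorm :: "'a measure \<Rightarrow> enat \<Rightarrow> ('a \<Rightarrow> 'v::real_normed_vector) \<Rightarrow> ennreal" where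
  "Lnorm M n f = (case n of
      enat m \<Rightarrow> (let I = (\<integral>\<^sup>+ x. ennreal (norm (f x) ^ m) \<partial>M) in
                 if I = \<infinity> then \<infinity> else ennreal (enn2real I powr (1 / real m)))
    | \<infinity> \<Rightarrow> Inf {C::ennreal. AE x in M. ennreal (norm (f x)) \<le> C})"

text \<open>Membership of (a representative of) a class in L^n(M;V).\<close>
definition Lmem :: "'a measure \<Rightarrow> enat \<Rightarrow> ('a \<Rightarrow> 'v::real_normed_vector) \<Rightarrow> bool" where
  "Lmem M n f \<longleftrightarrow> ae_strongly_measurable M f \<and> Lnorm M n f < \<infinity>"

text \<open>The library's has_bochner_integral requires second countability, so we repeat its
  definition (approximation in L^1 by simple integrable functions) with strong measurability.\<close>
definition has_bochner_int :: "'a measure \<Rightarrow> ('a \<Rightarrow> 'v::banach) \<Rightarrow> 'v \<Rightarrow> bool" where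
  "has_bochner_int M f v \<longleftrightarrow> strongly_measurable M f \<and>
     (\<exists>s. (\<forall>i. Bochner_Integration.simple_bochner_integrable M (s i)) \<and>
          (\<lambda>i. \<integral>\<^sup>+x. norm (f x - s i x) \<partial>M) \<longlonglongrightarrow> 0 \<and>
          (\<lambda>i. Bochner_Integration.simple_bochner_integral M (s i)) \<longlonglongrightarrow> v)"

definition bochner_integrable :: "'a measure \<Rightarrow> ('a \<Rightarrow> 'v::banach) \<Rightarrow> bool" where
  "bochner_integrable M f \<longleftrightarrow> (\<exists>v. has_bochner_int M f v)"

definition bochner_int :: "'a measure \<Rightarrow> ('a \<Rightarrow> 'v::banach) \<Rightarrow> 'v" where
  "bochner_int M f = (if bochner_integrable M f then (THE v. has_bochner_int M f v) else 0)"

definition kstar :: "('a \<Rightarrow> 'b measure) \<Rightarrow> ('b \<Rightarrow> 'v::banach) \<Rightarrow> 'a \<Rightarrow> 'v" where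
  "kstar k g x = bochner_int (k x) g"

definition mp_kernel :: "'a measure \<Rightarrow> 'b measure \<Rightarrow> ('a \<Rightarrow> 'b measure) \<Rightarrow> bool" where
  "mp_kernel p q k \<longleftrightarrow> prob_space p \<and> k \<in> p \<rightarrow>\<^sub>M prob_algebra q \<and> bind p k = q"

end

theory Submission
  imports Defs
begin

(* For p-almost every x the measure k(x) integrates norm g, since by measure preservation
   \<integral>\<integral> norm g dk(x) dp = \<integral> norm g dq < \<infinity>; there the Bochner integral k*g(x) exists and
   norm (k*g(x)) \<le> \<integral> norm g dk(x).  Raising this to the n-th power, Jensen's inequality and
   measure preservation bound the L^n norm of k*g by that of g (for n = \<infinity> an essential bound
   of g passes to k*g directly); by linearity this is the Lipschitz bound.  Measurability of k*g
   comes from approximating g pointwise by simple functions dominated by 2 norm g: their kernel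
   integrals are finite sums of the measurable functions x \<mapsto> k(A|x) v, and they converge to k*g
   by dominated convergence.  The same approximation, together with
   \<integral> l(A|y) k(dy|x) = (l \<circ> k)(A|x), gives functoriality. *)

section \<open>Strongly measurable functions\<close>

lemma separable_set_iff_closure_countable:
  "separable_set (T :: 'v::metric_space set) \<longleftrightarrow> (\<exists>C. countable C \<and> T \<subseteq> closure C)"
proof
  assume "separable_set T"
  then show "\<exists>C. countable C \<and> T \<subseteq> closure C" unfolding separable_set_def by blast
next
  assume "\<exists>C. countable C \<and> T \<subseteq> closure C"
  then obtain C where C: "countable C" and TC: "T \<subseteq> closure C" by blast
  define P where "P c n \<longleftrightarrow> (\<exists>t\<in>T. dist t c < inverse (real (Suc n)))" for c n
  define pick where "pick c n = (SOME t. t \<in> T \<and> dist t c < inverse (real (Suc n)))" for c n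
  define D where "D = (\<lambda>(c, n). pick c n) ` {(c, n). c \<in> C \<and> P c n}"
  have pick: "pick c n \<in> T \<and> dist (pick c n) c < inverse (real (Suc n))" if "P c n" for c n
    using that unfolding P_def pick_def by (metis (mono_tags, lifting) someI_ex)
  have "countable D"
  proof -
    have "countable (C \<times> (UNIV :: nat set))" using C by auto
    then have "countable {(c, n). c \<in> C \<and> P c n}" by (rule countable_subset[rotated]) auto
    then show ?thesis unfolding D_def by auto
  qed
  moreover have "D \<subseteq> T" using pick unfolding D_def by auto
  moreover have "T \<subseteq> closure D"
  proof
    fix t assume t: "t \<in> T"
    show "t \<in> closure D"
    proof (subst closure_approachable, intro allI impI)
      fix e :: real assume e: "e > 0"
      obtain n :: nat where n: "inverse (real (Suc n)) < e / 2"
        using reals_Archimedean[of "e/2"] e by auto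
      have "t \<in> closure C" "inverse (real (Suc n)) > 0" using t TC by auto
      then obtain c where c: "c \<in> C" "dist c t < inverse (real (Suc n))"
        unfolding closure_approachable by blast
      have Pc: "P c n" unfolding P_def using t c by (auto simp: dist_commute)
      have "dist (pick c n) t \<le> dist (pick c n) c + dist c t" by (rule dist_triangle)
      also have "\<dots> < e" using pick[OF Pc] c n by linarith
      finally show "\<exists>y\<in>D. dist y t < e" using c Pc unfolding D_def by auto
    qed
  qed
  ultimately show "separable_set T" unfolding separable_set_def by auto
qed

lemma strongly_measurable_simple_function:
  assumes "simple_function M s"
  shows "strongly_measurable M (s :: _ \<Rightarrow> 'v::real_normed_vector)"
  unfolding strongly_measurable_def separable_set_iff_closure_countable
proof
  show "s \<in> borel_measurable M" using assms by (rule borel_measurable_simple_function)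
  have "finite (s ` space M)" using assms by (simp add: simple_function_def)
  then show "\<exists>C. countable C \<and> s ` space M \<subseteq> closure C"
    by (intro exI[of _ "s ` space M"]) (auto intro: countable_finite closure_subset[THEN subsetD])
qed

lemma strongly_measurable_const: "strongly_measurable M (\<lambda>x. c)"
  by (rule strongly_measurable_simple_function) simp

lemma strongly_measurable_real:
  "\<phi> \<in> borel_measurable M \<Longrightarrow> strongly_measurable M (\<phi> :: _ \<Rightarrow> real)"
  unfolding strongly_measurable_def separable_set_iff_closure_countable
  using Rats_closure_real countable_rat by blast

lemma strongly_measurable_LIMSEQ:
  fixes f :: "nat \<Rightarrow> 'a \<Rightarrow> 'v::real_normed_vector"
  assumes f: "\<And>i. strongly_measurable M (f i)"
    and lim: "\<And>x. x \<in> space M \<Longrightarrow> (\<lambda>i. f i x) \<longlonglongrightarrow> g x"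
  shows "strongly_measurable M g"
  unfolding strongly_measurable_def
proof
  show "g \<in> borel_measurable M"
    using f by (rule_tac borel_measurable_LIMSEQ_metric[of f _ g])
      (simp_all add: strongly_measurable_def lim)
  have "\<forall>i. \<exists>C. countable C \<and> f i ` space M \<subseteq> closure C"
    using f by (simp add: strongly_measurable_def separable_set_iff_closure_countable)
  then obtain C where "\<forall>i. countable (C i) \<and> f i ` space M \<subseteq> closure (C i)"
    by (subst (asm) choice_iff) blast
  then have C: "\<And>i. countable (C i)" "\<And>i. f i ` space M \<subseteq> closure (C i)" by simp_all
  have "g ` space M \<subseteq> closure (\<Union>i. C i)"
  proof
    fix y assume "y \<in> g ` space M"
    then obtain x where x: "x \<in> space M" "y = g x" by auto
    have "f i x \<in> closure (\<Union>i. C i)" for i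
    proof -
      have "f i x \<in> closure (C i)" using C(2)[of i] x(1) by blast
      moreover have "closure (C i) \<subseteq> closure (\<Union>i. C i)" by (rule closure_mono) blast
      ultimately show ?thesis by blast
    qed
    then show "y \<in> closure (\<Union>i. C i)"
      using x(2) closed_sequentially[OF closed_closure _ lim[OF x(1)]] by blast
  qed
  moreover have "countable (\<Union>i. C i)" using C(1) by (intro countable_UN) auto
  ultimately show "separable_set (g ` space M)"
    unfolding separable_set_iff_closure_countable by blast
qed

lemma simple_function_nearest_point:
  fixes f :: "'a \<Rightarrow> 'v::metric_space" and e :: "nat \<Rightarrow> 'v"
  assumes f: "f \<in> borel_measurable M"
  obtains s where "\<And>i. simple_function M (s i)"
    "\<And>i x l. l \<le> i \<Longrightarrow> dist (f x) (s i x) \<le> dist (f x) (e l)"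
proof -
  define P where "P i x j \<longleftrightarrow> j \<le> i \<and> (\<forall>l\<le>i. dist (f x) (e j) \<le> dist (f x) (e l))" for i x j
  define idx where "idx i x = (LEAST j. P i x j)" for i x
  have "\<exists>j. P i x j" for i x
  proof -
    let ?S = "(\<lambda>l. dist (f x) (e l)) ` {..i}"
    have "Min ?S \<in> ?S" by (intro Min_in) auto
    then obtain j where "j \<le> i" "dist (f x) (e j) = Min ?S"
      by (metis (no_types, lifting) atMost_iff imageE)
    then show ?thesis unfolding P_def by (auto intro: Min_le)
  qed
  then have P_idx: "P i x (idx i x)" for i x
    unfolding idx_def by (rule LeastI_ex)
  have "simple_function M (\<lambda>x. e (idx i x))" for i
    unfolding simple_function_eq_measurable
  proof
    have "(\<lambda>x. e (idx i x)) ` space M \<subseteq> e ` {..i}" using P_idx unfolding P_def by auto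
    then show "finite ((\<lambda>x. e (idx i x)) ` space M)" by (rule finite_subset) simp
    have [measurable]: "(\<lambda>x. dist (f x) c) \<in> borel_measurable M" for c
      using measurable_compose[OF f borel_measurable_continuous_onI[of "\<lambda>v. dist v c"]]
      by (simp add: comp_def continuous_on_dist)
    have "Measurable.pred M (\<lambda>x. P i x j)" for j
      unfolding P_def by measurable
    then have "idx i \<in> measurable M (count_space UNIV)"
      unfolding idx_def by (rule measurable_Least)
    then show "(\<lambda>x. e (idx i x)) \<in> measurable M (count_space UNIV)"
      by (rule measurable_compose) simp
  qed
  moreover have "dist (f x) (e (idx i x)) \<le> dist (f x) (e l)" if "l \<le> i" for i x l
    using P_idx[of i x] that unfolding P_def by blast
  ultimately show ?thesis by (rule that)
qed

(* Nearest points among 0 followed by an enumeration of a countable dense subset of the range;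
   starting with 0 gives the bound by 2 * norm (f x). *)
lemma strongly_measurable_simple_approx:
  fixes f :: "'a \<Rightarrow> 'v::real_normed_vector"
  assumes "strongly_measurable M f"
  obtains s where "\<And>i. simple_function M (s i)"
    "\<And>x. x \<in> space M \<Longrightarrow> (\<lambda>i. s i x) \<longlonglongrightarrow> f x"
    "\<And>i x. x \<in> space M \<Longrightarrow> norm (s i x) \<le> 2 * norm (f x)"
proof -
  obtain D where D: "countable D" "f ` space M \<subseteq> closure D"
    using assms unfolding strongly_measurable_def separable_set_def by blast
  define e where "e j = (if j = 0 then 0 else from_nat_into D (j - 1))" for j :: nat
  have eD: "\<exists>j. e j = d" if dD: "d \<in> D" for d
  proof -
    obtain n where "from_nat_into D n = d" using from_nat_into_surj[OF D(1) dD] by blast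
    then show ?thesis by (intro exI[of _ "Suc n"]) (simp add: e_def)
  qed
  have "f \<in> borel_measurable M" using assms by (simp add: strongly_measurable_def)
  then obtain s where simple: "\<And>i. simple_function M (s i)"
    and close: "\<And>i x l. l \<le> i \<Longrightarrow> dist (f x) (s i x) \<le> dist (f x) (e l)"
    using simple_function_nearest_point[where e=e] by blast
  show ?thesis
  proof (rule that[OF simple])
    fix x assume x: "x \<in> space M"
    show "(\<lambda>i. s i x) \<longlonglongrightarrow> f x"
    proof (rule metric_LIMSEQ_I)
      fix r :: real assume r: "0 < r"
      have "f x \<in> closure D" using D(2) x by blast
      then obtain d where d: "d \<in> D" "dist d (f x) < r"
        using r unfolding closure_approachable by blast
      obtain j where j: "e j = d" using eD[OF d(1)] by blast
      have "dist (s n x) (f x) < r" if "n \<ge> j" for n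
        using close[OF that, of x] d(2) j by (simp add: dist_commute)
      then show "\<exists>no. \<forall>n\<ge>no. dist (s n x) (f x) < r" by blast
    qed
  next
    fix i x
    have "dist (f x) (s i x) \<le> norm (f x)"
      using close[of 0 i x] by (simp add: e_def)
    then show "norm (s i x) \<le> 2 * norm (f x)"
      by (smt (verit) dist_norm norm_minus_commute norm_triangle_ineq2)
  qed
qed

lemma strongly_measurable_compose2:
  fixes f :: "'a \<Rightarrow> 'v::real_normed_vector" and g :: "'a \<Rightarrow> 'w::real_normed_vector"
    and h :: "'v \<Rightarrow> 'w \<Rightarrow> 'u::real_normed_vector"
  assumes f: "strongly_measurable M f" and g: "strongly_measurable M g"
    and h: "\<And>a b A B. a \<longlonglongrightarrow> A \<Longrightarrow> b \<longlonglongrightarrow> B \<Longrightarrow> (\<lambda>i. h (a i) (b i)) \<longlonglongrightarrow> h A B"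
  shows "strongly_measurable M (\<lambda>x. h (f x) (g x))"
proof -
  obtain s where s: "\<And>i. simple_function M (s i)" "\<And>x. x \<in> space M \<Longrightarrow> (\<lambda>i. s i x) \<longlonglongrightarrow> f x"
    using strongly_measurable_simple_approx[OF f] by metis
  obtain t where t: "\<And>i. simple_function M (t i)" "\<And>x. x \<in> space M \<Longrightarrow> (\<lambda>i. t i x) \<longlonglongrightarrow> g x"
    using strongly_measurable_simple_approx[OF g] by metis
  show ?thesis
  proof (rule strongly_measurable_LIMSEQ)
    show "strongly_measurable M (\<lambda>x. h (s i x) (t i x))" for i
      by (rule strongly_measurable_simple_function[OF simple_function_compose2[OF s(1) t(1)]])
    show "(\<lambda>i. h (s i x) (t i x)) \<longlonglongrightarrow> h (f x) (g x)" if "x \<in> space M" for x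
      by (rule h[OF s(2)[OF that] t(2)[OF that]])
  qed
qed

lemma strongly_measurable_add:
  "strongly_measurable M f \<Longrightarrow> strongly_measurable M g \<Longrightarrow>
    strongly_measurable M (\<lambda>x. f x + g x :: 'v::real_normed_vector)"
  by (rule strongly_measurable_compose2[where h="(+)"]) (auto intro: tendsto_add)

lemma strongly_measurable_diff:
  "strongly_measurable M f \<Longrightarrow> strongly_measurable M g \<Longrightarrow>
    strongly_measurable M (\<lambda>x. f x - g x :: 'v::real_normed_vector)"
  by (rule strongly_measurable_compose2[where h="(-)"]) (auto intro: tendsto_diff)

lemma strongly_measurable_scaleR:
  "strongly_measurable M (\<phi> :: _ \<Rightarrow> real) \<Longrightarrow> strongly_measurable M f \<Longrightarrow>
    strongly_measurable M (\<lambda>x. \<phi> x *\<^sub>R f x :: 'v::real_normed_vector)"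
  by (rule strongly_measurable_compose2[where h="(*\<^sub>R)"]) (auto intro: tendsto_scaleR)

lemma strongly_measurable_sum:
  "finite I \<Longrightarrow> (\<And>i. i \<in> I \<Longrightarrow> strongly_measurable M (f i)) \<Longrightarrow>
    strongly_measurable M (\<lambda>x. \<Sum>i\<in>I. f i x :: 'v::real_normed_vector)"
  by (induction I rule: finite_induct)
    (auto intro: strongly_measurable_add strongly_measurable_const)

lemma strongly_measurable_cong:
  assumes "strongly_measurable M f" "\<And>x. x \<in> space M \<Longrightarrow> f x = g x"
  shows "strongly_measurable M g"
proof -
  have "g ` space M = f ` space M" using assms(2) by auto
  moreover have "g \<in> borel_measurable M"
    using assms measurable_cong[of M f g] by (auto simp: strongly_measurable_def)
  ultimately show ?thesis using assms(1) unfolding strongly_measurable_def by simp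
qed

lemma strongly_measurable_cong_sets:
  fixes f :: "'a \<Rightarrow> 'v::real_normed_vector"
  assumes "sets N = sets M"
  shows "strongly_measurable N f \<longleftrightarrow> strongly_measurable M f"
  using sets_eq_imp_space_eq[OF assms] measurable_cong_sets[OF assms refl, of "borel :: 'v measure"]
  unfolding strongly_measurable_def by simp

lemma borel_measurable_norm_strongly:
  "strongly_measurable M (f :: _ \<Rightarrow> 'v::real_normed_vector) \<Longrightarrow>
    (\<lambda>x. norm (f x)) \<in> borel_measurable M"
  unfolding strongly_measurable_def
  using measurable_compose[OF _ borel_measurable_continuous_onI[OF continuous_on_norm_id]]
  by (auto simp: comp_def)

lemma borel_measurable_ennreal_norm_strongly:
  "strongly_measurable M (f :: _ \<Rightarrow> 'v::real_normed_vector) \<Longrightarrow>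
    (\<lambda>x. ennreal (norm (f x))) \<in> borel_measurable M"
  using borel_measurable_norm_strongly by measurable

section \<open>Bochner integral of strongly measurable functions\<close>

(* The results of Bochner_Integration assume a second-countable codomain; the ones needed here
   are redone for strongly measurable functions, mostly by passing to real-valued norms. *)

lemma simple_bochner_integrable_finite_measure:
  "finite_measure M \<Longrightarrow> simple_function M s \<Longrightarrow> Bochner_Integration.simple_bochner_integrable M s"
  by (rule simple_bochner_integrable.intros) (auto simp: finite_measure.emeasure_finite)

lemma strongly_measurable_simple_bochner_integrable:
  "Bochner_Integration.simple_bochner_integrable M s \<Longrightarrow>
    strongly_measurable M (s :: _ \<Rightarrow> 'v::real_normed_vector)"
  by (auto elim: simple_bochner_integrable.cases intro: strongly_measurable_simple_function)

lemma simple_bochner_integral_bounded_strongly: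
  fixes f :: "'a \<Rightarrow> 'b::real_normed_vector"
  assumes f: "strongly_measurable M f"
    and s: "Bochner_Integration.simple_bochner_integrable M s"
    and t: "Bochner_Integration.simple_bochner_integrable M t"
  shows "ennreal (norm (Bochner_Integration.simple_bochner_integral M s -
      Bochner_Integration.simple_bochner_integral M t)) \<le>
    (\<integral>\<^sup>+ x. norm (f x - s x) \<partial>M) + (\<integral>\<^sup>+ x. norm (f x - t x) \<partial>M)"
    (is "ennreal (norm (?s - ?t)) \<le> ?S + ?T")
proof -
  have "ennreal (norm (?s - ?t)) =
      norm (Bochner_Integration.simple_bochner_integral M (\<lambda>x. s x - t x))"
    using s t by (subst simple_bochner_integral_diff) auto
  also have "\<dots> \<le> Bochner_Integration.simple_bochner_integral M (\<lambda>x. norm (s x - t x))"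
    using simple_bochner_integrable_compose2[of "(-)" M "s" "t"] s t
    by (auto intro!: simple_bochner_integral_norm_bound)
  also have "\<dots> = (\<integral>\<^sup>+x. norm (s x - t x) \<partial>M)"
    using simple_bochner_integrable_compose2[of "\<lambda>x y. norm (x - y)" M "s" "t"] s t
    by (auto intro!: simple_bochner_integral_eq_nn_integral)
  also have "\<dots> \<le> (\<integral>\<^sup>+x. ennreal (norm (f x - s x)) + ennreal (norm (f x - t x)) \<partial>M)"
    by (intro nn_integral_mono, simp flip: ennreal_plus)
      (metis norm_diff_triangle_le norm_minus_commute order_refl)
  also have "\<dots> = ?S + ?T"
    by (intro nn_integral_add borel_measurable_ennreal_norm_strongly strongly_measurable_diff f
        strongly_measurable_simple_bochner_integrable s t)
  finally show ?thesis .
qed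

lemma has_bochner_intI:
  assumes "strongly_measurable M f" "\<And>i. Bochner_Integration.simple_bochner_integrable M (s i)"
    "(\<lambda>i. \<integral>\<^sup>+x. norm (f x - s i x) \<partial>M) \<longlonglongrightarrow> 0"
    "(\<lambda>i. Bochner_Integration.simple_bochner_integral M (s i)) \<longlonglongrightarrow> v"
  shows "has_bochner_int M f v"
  using assms unfolding has_bochner_int_def by blast

lemma ennreal_tendsto_0_le:
  fixes a b :: "nat \<Rightarrow> ennreal"
  assumes "\<And>i. a i \<le> b i" "b \<longlonglongrightarrow> 0"
  shows "a \<longlonglongrightarrow> 0"
  by (rule tendsto_sandwich[where f="\<lambda>_. 0" and h=b]) (use assms in auto)

lemma has_bochner_int_unique:
  fixes f :: "'a \<Rightarrow> 'b::banach"
  assumes "has_bochner_int M f v" "has_bochner_int M f w"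
  shows "v = w"
proof -
  obtain s where f: "strongly_measurable M f"
    and s: "\<And>i. Bochner_Integration.simple_bochner_integrable M (s i)"
    and S: "(\<lambda>i. \<integral>\<^sup>+ x. norm (f x - s i x) \<partial>M) \<longlonglongrightarrow> 0"
    and sv: "(\<lambda>i. Bochner_Integration.simple_bochner_integral M (s i)) \<longlonglongrightarrow> v"
    using assms(1) unfolding has_bochner_int_def by blast
  obtain t where t: "\<And>i. Bochner_Integration.simple_bochner_integrable M (t i)"
    and T: "(\<lambda>i. \<integral>\<^sup>+ x. norm (f x - t i x) \<partial>M) \<longlonglongrightarrow> 0"
    and tw: "(\<lambda>i. Bochner_Integration.simple_bochner_integral M (t i)) \<longlonglongrightarrow> w"
    using assms(2) unfolding has_bochner_int_def by blast
  let ?d = "\<lambda>i. norm (Bochner_Integration.simple_bochner_integral M (s i) -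
      Bochner_Integration.simple_bochner_integral M (t i))"
  have "(\<lambda>i. ennreal (?d i)) \<longlonglongrightarrow> 0"
  proof (rule ennreal_tendsto_0_le)
    show "ennreal (?d i) \<le> (\<integral>\<^sup>+ x. norm (f x - s i x) \<partial>M) + (\<integral>\<^sup>+ x. norm (f x - t i x) \<partial>M)"
      for i by (rule simple_bochner_integral_bounded_strongly[OF f s t])
    show "(\<lambda>i. (\<integral>\<^sup>+ x. norm (f x - s i x) \<partial>M) + (\<integral>\<^sup>+ x. norm (f x - t i x) \<partial>M)) \<longlonglongrightarrow> 0"
      using tendsto_add[OF S T] by simp
  qed
  then have "?d \<longlonglongrightarrow> 0"
    by (simp flip: ennreal_0)
  moreover have "?d \<longlonglongrightarrow> norm (v - w)"
    using sv tw by (intro tendsto_intros)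
  ultimately have "norm (v - w) = 0"
    by (rule LIMSEQ_unique[rotated])
  then show "v = w" by simp
qed

lemma bochner_int_eqI: "has_bochner_int M f v \<Longrightarrow> bochner_int M f = v"
  unfolding bochner_int_def bochner_integrable_def
  using has_bochner_int_unique by (metis (mono_tags, lifting) the_equality)

lemma has_bochner_int_norm_le:
  fixes f :: "'a \<Rightarrow> 'b::banach"
  assumes "has_bochner_int M f v"
  shows "ennreal (norm v) \<le> (\<integral>\<^sup>+x. norm (f x) \<partial>M)"
proof -
  obtain s where f: "strongly_measurable M f"
    and s: "\<And>i. Bochner_Integration.simple_bochner_integrable M (s i)"
    and S: "(\<lambda>i. \<integral>\<^sup>+ x. norm (f x - s i x) \<partial>M) \<longlonglongrightarrow> 0"
    and sv: "(\<lambda>i. Bochner_Integration.simple_bochner_integral M (s i)) \<longlonglongrightarrow> v"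
    using assms unfolding has_bochner_int_def by blast
  let ?t = "\<lambda>i. (\<integral>\<^sup>+x. norm (f x - s i x) \<partial>M) + (\<integral>\<^sup>+x. norm (f x) \<partial>M)"
  show ?thesis
  proof (rule LIMSEQ_le)
    show "(\<lambda>i. ennreal (norm (Bochner_Integration.simple_bochner_integral M (s i)))) \<longlonglongrightarrow> norm v"
      using sv by (auto simp: tendsto_ennreal_iff intro: tendsto_intros)
    have "?t \<longlonglongrightarrow> 0 + (\<integral>\<^sup>+ x. ennreal (norm (f x)) \<partial>M)"
      by (intro tendsto_add tendsto_const S)
    then show "?t \<longlonglongrightarrow> \<integral>\<^sup>+ x. ennreal (norm (f x)) \<partial>M"
      by simp
    show "\<exists>N. \<forall>i\<ge>N. norm (Bochner_Integration.simple_bochner_integral M (s i)) \<le> ?t i"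
    proof (intro exI allI impI)
      fix i
      have "ennreal (norm (Bochner_Integration.simple_bochner_integral M (s i))) \<le>
          Bochner_Integration.simple_bochner_integral M (\<lambda>x. norm (s i x))"
        by (auto intro!: simple_bochner_integral_norm_bound s)
      also have "\<dots> = (\<integral>\<^sup>+x. norm (s i x) \<partial>M)"
        by (intro simple_bochner_integral_eq_nn_integral)
          (auto intro: s simple_bochner_integrable_compose2)
      also have "\<dots> \<le> (\<integral>\<^sup>+x. ennreal (norm (f x - s i x)) + norm (f x) \<partial>M)"
        by (auto intro!: nn_integral_mono simp flip: ennreal_plus)
          (metis add.commute norm_minus_commute norm_triangle_sub)
      also have "\<dots> = ?t i"
        by (intro nn_integral_add borel_measurable_ennreal_norm_strongly strongly_measurable_diff f
            strongly_measurable_simple_bochner_integrable s)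
      finally show "norm (Bochner_Integration.simple_bochner_integral M (s i)) \<le> ?t i" .
    qed
  qed
qed

lemma AE_norm_le_LIMSEQ:
  fixes f :: "'a \<Rightarrow> 'b::real_normed_vector"
  assumes bound: "\<And>i. AE x in M. norm (F i x) \<le> w x"
    and lim: "AE x in M. (\<lambda>i. F i x) \<longlonglongrightarrow> f x"
  shows "AE x in M. norm (f x) \<le> w x"
proof -
  have "AE x in M. \<forall>i. norm (F i x) \<le> w x"
    using bound by (simp add: AE_all_countable)
  then show ?thesis
    using lim by eventually_elim (auto intro: LIMSEQ_le_const2[OF tendsto_norm])
qed

lemma nn_integral_dominated_convergence_norm_strongly:
  fixes f :: "'a \<Rightarrow> 'b::real_normed_vector"
  assumes F: "\<And>i. strongly_measurable M (F i)" and f: "strongly_measurable M f"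
    and w: "w \<in> borel_measurable M" and bound: "\<And>i. AE x in M. norm (F i x) \<le> w x"
    and w_fin: "(\<integral>\<^sup>+x. w x \<partial>M) < \<infinity>" and lim: "AE x in M. (\<lambda>i. F i x) \<longlonglongrightarrow> f x"
  shows "(\<lambda>i. \<integral>\<^sup>+x. norm (f x - F i x) \<partial>M) \<longlonglongrightarrow> 0"
proof -
  have "(\<lambda>i. \<integral>\<^sup>+x. norm (0 - norm (f x - F i x)) \<partial>M) \<longlonglongrightarrow> 0"
  proof (rule nn_integral_dominated_convergence_norm[where w="\<lambda>x. 2 * w x"])
    show "(\<lambda>x. norm (f x - F i x)) \<in> borel_measurable M" for i
      by (intro borel_measurable_norm_strongly strongly_measurable_diff f F)
    show "AE x in M. norm (norm (f x - F i x)) \<le> 2 * w x" for i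
      using bound[of i] AE_norm_le_LIMSEQ[OF bound lim]
    proof eventually_elim
      case (elim x)
      then show ?case using norm_triangle_ineq4[of "f x" "F i x"] by simp
    qed
    show "AE x in M. (\<lambda>i. norm (f x - F i x)) \<longlonglongrightarrow> 0"
      using lim
    proof eventually_elim
      case (elim x)
      have "(\<lambda>i. f x - F i x) \<longlonglongrightarrow> f x - f x" by (intro tendsto_diff tendsto_const elim)
      then show ?case using tendsto_norm_zero by force
    qed
    have "(\<integral>\<^sup>+x. ennreal (2 * w x) \<partial>M) = 2 * (\<integral>\<^sup>+x. w x \<partial>M)"
      using w by (subst nn_integral_cmult[symmetric]) (auto simp: ennreal_mult')
    then show "(\<integral>\<^sup>+x. ennreal (2 * w x) \<partial>M) < \<infinity>"
      using w_fin by (simp add: ennreal_mult_less_top)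
  qed (use w in auto)
  then show ?thesis by simp
qed

lemma Cauchy_simple_bochner_integral:
  fixes f :: "'a \<Rightarrow> 'b::real_normed_vector"
  assumes f: "strongly_measurable M f"
    and s: "\<And>i. Bochner_Integration.simple_bochner_integrable M (s i)"
    and approx: "(\<lambda>i. \<integral>\<^sup>+x. norm (f x - s i x) \<partial>M) \<longlonglongrightarrow> 0"
  shows "Cauchy (\<lambda>i. Bochner_Integration.simple_bochner_integral M (s i))"
proof (rule metric_CauchyI)
  fix e :: real assume "0 < e"
  then obtain N where N: "\<And>i. i \<ge> N \<Longrightarrow> (\<integral>\<^sup>+x. norm (f x - s i x) \<partial>M) < ennreal (e / 2)"
    using order_tendstoD(2)[OF approx, of "ennreal (e / 2)"] by (auto simp: eventually_sequentially)
  have "dist (Bochner_Integration.simple_bochner_integral M (s m))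
      (Bochner_Integration.simple_bochner_integral M (s n)) < e" if "m \<ge> N" "n \<ge> N" for m n
  proof -
    have "ennreal (dist (Bochner_Integration.simple_bochner_integral M (s m))
        (Bochner_Integration.simple_bochner_integral M (s n))) \<le>
        (\<integral>\<^sup>+x. norm (f x - s m x) \<partial>M) + (\<integral>\<^sup>+x. norm (f x - s n x) \<partial>M)"
      unfolding dist_norm by (rule simple_bochner_integral_bounded_strongly[OF f s s])
    also have "\<dots> < ennreal (e / 2) + ennreal (e / 2)"
      using N that by (intro add_strict_mono)
    also have "\<dots> = ennreal e"
      using \<open>0 < e\<close> by (simp flip: ennreal_plus)
    finally show ?thesis by (simp add: ennreal_less_iff)
  qed
  then show "\<exists>K. \<forall>m\<ge>K. \<forall>n\<ge>K. dist (Bochner_Integration.simple_bochner_integral M (s m))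
      (Bochner_Integration.simple_bochner_integral M (s n)) < e"
    by blast
qed

lemma has_bochner_int_simple_approx:
  fixes f :: "'a \<Rightarrow> 'b::banach"
  assumes f: "strongly_measurable M f" and fin: "(\<integral>\<^sup>+x. norm (f x) \<partial>M) < \<infinity>"
    and s: "\<And>i. simple_function M (s i)" "\<And>x. x \<in> space M \<Longrightarrow> (\<lambda>i. s i x) \<longlonglongrightarrow> f x"
      "\<And>i x. x \<in> space M \<Longrightarrow> norm (s i x) \<le> 2 * norm (f x)"
  shows "has_bochner_int M f (bochner_int M f)"
    and "(\<lambda>i. Bochner_Integration.simple_bochner_integral M (s i)) \<longlonglongrightarrow> bochner_int M f"
proof -
  have [measurable]: "(\<lambda>x. norm (f x)) \<in> borel_measurable M"
    by (rule borel_measurable_norm_strongly[OF f])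
  have fin2: "(\<integral>\<^sup>+x. ennreal (2 * norm (f x)) \<partial>M) < \<infinity>"
    using fin by (simp add: ennreal_mult nn_integral_cmult ennreal_mult_less_top)
  have sbi: "Bochner_Integration.simple_bochner_integrable M (s i)" for i
  proof (rule simple_bochner_integrableI_bounded[OF s(1)])
    have "(\<integral>\<^sup>+x. norm (s i x) \<partial>M) \<le> (\<integral>\<^sup>+x. ennreal (2 * norm (f x)) \<partial>M)"
      using s(3) by (intro nn_integral_mono ennreal_leI)
    then show "(\<integral>\<^sup>+x. norm (s i x) \<partial>M) < \<infinity>" using fin2 by (rule le_less_trans)
  qed
  have approx: "(\<lambda>i. \<integral>\<^sup>+x. norm (f x - s i x) \<partial>M) \<longlonglongrightarrow> 0"
    by (rule nn_integral_dominated_convergence_norm_strongly[OF _ f _ _ fin2])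
      (use s in \<open>auto intro!: AE_I2 strongly_measurable_simple_function\<close>)
  obtain v where v: "(\<lambda>i. Bochner_Integration.simple_bochner_integral M (s i)) \<longlonglongrightarrow> v"
    using Cauchy_simple_bochner_integral[OF f sbi approx] Cauchy_convergent_iff convergent_def
    by blast
  have "has_bochner_int M f v" by (rule has_bochner_intI[OF f sbi approx v])
  moreover from this have "bochner_int M f = v" by (rule bochner_int_eqI)
  ultimately show "has_bochner_int M f (bochner_int M f)"
    and "(\<lambda>i. Bochner_Integration.simple_bochner_integral M (s i)) \<longlonglongrightarrow> bochner_int M f"
    using v by simp_all
qed

lemma has_bochner_int_bochner_int:
  fixes f :: "'a \<Rightarrow> 'b::banach"
  assumes "strongly_measurable M f" "(\<integral>\<^sup>+x. norm (f x) \<partial>M) < \<infinity>"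
  shows "has_bochner_int M f (bochner_int M f)"
  using assms by (metis strongly_measurable_simple_approx has_bochner_int_simple_approx(1))

lemma has_bochner_int_add:
  fixes f g :: "'a \<Rightarrow> 'b::banach"
  assumes "has_bochner_int M f v" "has_bochner_int M g w"
  shows "has_bochner_int M (\<lambda>x. f x + g x) (v + w)"
proof -
  obtain s where f: "strongly_measurable M f"
    and s: "\<And>i. Bochner_Integration.simple_bochner_integrable M (s i)"
    and S: "(\<lambda>i. \<integral>\<^sup>+ x. norm (f x - s i x) \<partial>M) \<longlonglongrightarrow> 0"
    and sv: "(\<lambda>i. Bochner_Integration.simple_bochner_integral M (s i)) \<longlonglongrightarrow> v"
    using assms(1) unfolding has_bochner_int_def by blast
  obtain t where g: "strongly_measurable M g"
    and t: "\<And>i. Bochner_Integration.simple_bochner_integrable M (t i)"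
    and T: "(\<lambda>i. \<integral>\<^sup>+ x. norm (g x - t i x) \<partial>M) \<longlonglongrightarrow> 0"
    and tw: "(\<lambda>i. Bochner_Integration.simple_bochner_integral M (t i)) \<longlonglongrightarrow> w"
    using assms(2) unfolding has_bochner_int_def by blast
  show ?thesis
  proof (rule has_bochner_intI)
    show "strongly_measurable M (\<lambda>x. f x + g x)" by (rule strongly_measurable_add[OF f g])
    show "Bochner_Integration.simple_bochner_integrable M (\<lambda>x. s i x + t i x)" for i
      using simple_bochner_integrable_compose2[of "(+)" M "s i" "t i"] s t by auto
    show "(\<lambda>i. Bochner_Integration.simple_bochner_integral M (\<lambda>x. s i x + t i x)) \<longlonglongrightarrow> v + w"
      using tendsto_add[OF sv tw] by (simp add: simple_bochner_integral_add[OF s t])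
    have le: "(\<integral>\<^sup>+ x. norm (f x + g x - (s i x + t i x)) \<partial>M) \<le>
        (\<integral>\<^sup>+ x. norm (f x - s i x) \<partial>M) + (\<integral>\<^sup>+ x. norm (g x - t i x) \<partial>M)" for i
    proof -
      have "(\<integral>\<^sup>+ x. norm (f x + g x - (s i x + t i x)) \<partial>M) \<le>
          (\<integral>\<^sup>+ x. ennreal (norm (f x - s i x)) + ennreal (norm (g x - t i x)) \<partial>M)"
      proof (rule nn_integral_mono)
        fix x
        have "norm (f x + g x - (s i x + t i x)) \<le> norm (f x - s i x) + norm (g x - t i x)"
          by (metis add_diff_add norm_triangle_ineq)
        then show "ennreal (norm (f x + g x - (s i x + t i x))) \<le>
            ennreal (norm (f x - s i x)) + ennreal (norm (g x - t i x))"
          by (simp flip: ennreal_plus)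
      qed
      also have "\<dots> = (\<integral>\<^sup>+ x. norm (f x - s i x) \<partial>M) + (\<integral>\<^sup>+ x. norm (g x - t i x) \<partial>M)"
        by (intro nn_integral_add borel_measurable_ennreal_norm_strongly strongly_measurable_diff
            f g strongly_measurable_simple_bochner_integrable s t)
      finally show ?thesis .
    qed
    show "(\<lambda>i. \<integral>\<^sup>+ x. norm (f x + g x - (s i x + t i x)) \<partial>M) \<longlonglongrightarrow> 0"
      using tendsto_add[OF S T] by (intro ennreal_tendsto_0_le[OF le]) simp
  qed
qed

lemma has_bochner_int_scaleR_right:
  fixes f :: "'a \<Rightarrow> 'b::banach"
  assumes "has_bochner_int M f v"
  shows "has_bochner_int M (\<lambda>x. c *\<^sub>R f x) (c *\<^sub>R v)"
proof -
  obtain s where f: "strongly_measurable M f"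
    and s: "\<And>i. Bochner_Integration.simple_bochner_integrable M (s i)"
    and S: "(\<lambda>i. \<integral>\<^sup>+ x. norm (f x - s i x) \<partial>M) \<longlonglongrightarrow> 0"
    and sv: "(\<lambda>i. Bochner_Integration.simple_bochner_integral M (s i)) \<longlonglongrightarrow> v"
    using assms unfolding has_bochner_int_def by blast
  show ?thesis
  proof (rule has_bochner_intI)
    show "strongly_measurable M (\<lambda>x. c *\<^sub>R f x)"
      by (rule strongly_measurable_scaleR[OF strongly_measurable_const f])
    show "Bochner_Integration.simple_bochner_integrable M (\<lambda>x. c *\<^sub>R s i x)" for i
      using simple_bochner_integrable_compose2[of "\<lambda>a b. c *\<^sub>R a" M "s i" "s i"] s by auto
    have "Bochner_Integration.simple_bochner_integral M (\<lambda>x. c *\<^sub>R s i x) =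
        c *\<^sub>R Bochner_Integration.simple_bochner_integral M (s i)" for i
      by (rule simple_bochner_integral_linear[OF _ s])
        (simp add: bounded_linear.linear[OF bounded_linear_scaleR_right])
    then show "(\<lambda>i. Bochner_Integration.simple_bochner_integral M (\<lambda>x. c *\<^sub>R s i x)) \<longlonglongrightarrow> c *\<^sub>R v"
      using tendsto_scaleR[OF tendsto_const sv] by simp
    have "(\<integral>\<^sup>+ x. norm (c *\<^sub>R f x - c *\<^sub>R s i x) \<partial>M) =
        ennreal \<bar>c\<bar> * (\<integral>\<^sup>+ x. norm (f x - s i x) \<partial>M)" for i
    proof -
      have "(\<integral>\<^sup>+ x. norm (c *\<^sub>R f x - c *\<^sub>R s i x) \<partial>M) =
          (\<integral>\<^sup>+ x. ennreal \<bar>c\<bar> * ennreal (norm (f x - s i x)) \<partial>M)"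
        by (intro nn_integral_cong)
          (simp add: ennreal_mult[symmetric] flip: scaleR_diff_right)
      also have "\<dots> = ennreal \<bar>c\<bar> * (\<integral>\<^sup>+ x. norm (f x - s i x) \<partial>M)"
        by (intro nn_integral_cmult borel_measurable_ennreal_norm_strongly strongly_measurable_diff
            f strongly_measurable_simple_bochner_integrable s)
      finally show ?thesis .
    qed
    moreover have "(\<lambda>i. ennreal \<bar>c\<bar> * (\<integral>\<^sup>+ x. norm (f x - s i x) \<partial>M)) \<longlonglongrightarrow> ennreal \<bar>c\<bar> * 0"
      by (rule ennreal_tendsto_cmult[OF _ S]) simp
    ultimately show "(\<lambda>i. \<integral>\<^sup>+ x. norm (c *\<^sub>R f x - c *\<^sub>R s i x) \<partial>M) \<longlonglongrightarrow> 0" by simp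
  qed
qed

lemma has_bochner_int_diff:
  fixes f g :: "'a \<Rightarrow> 'b::banach"
  assumes "has_bochner_int M f v" "has_bochner_int M g w"
  shows "has_bochner_int M (\<lambda>x. f x - g x) (v - w)"
  using has_bochner_int_add[OF assms(1) has_bochner_int_scaleR_right[OF assms(2), of "-1"]] by simp

lemma has_bochner_int_zero: "has_bochner_int M (\<lambda>x. 0 :: 'b::banach) 0"
  by (rule has_bochner_intI[where s="\<lambda>i x. 0"])
    (auto intro: strongly_measurable_const simple_bochner_integrable.intros
      simp: simple_bochner_integral_def image_constant_conv)

lemma has_bochner_int_sum:
  fixes f :: "'i \<Rightarrow> 'a \<Rightarrow> 'b::banach"
  shows "finite I \<Longrightarrow> (\<And>i. i \<in> I \<Longrightarrow> has_bochner_int M (f i) (v i)) \<Longrightarrow>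
    has_bochner_int M (\<lambda>x. \<Sum>i\<in>I. f i x) (\<Sum>i\<in>I. v i)"
  by (induction I rule: finite_induct) (auto intro: has_bochner_int_zero has_bochner_int_add)

lemma has_bochner_int_cong_AE:
  assumes "has_bochner_int M f v" "strongly_measurable M g" "AE x in M. f x = g x"
  shows "has_bochner_int M g v"
proof -
  obtain s where s: "\<And>i. Bochner_Integration.simple_bochner_integrable M (s i)"
    and S: "(\<lambda>i. \<integral>\<^sup>+ x. norm (f x - s i x) \<partial>M) \<longlonglongrightarrow> 0"
    and sv: "(\<lambda>i. Bochner_Integration.simple_bochner_integral M (s i)) \<longlonglongrightarrow> v"
    using assms(1) unfolding has_bochner_int_def by blast
  have "(\<integral>\<^sup>+ x. norm (f x - s i x) \<partial>M) = (\<integral>\<^sup>+ x. norm (g x - s i x) \<partial>M)" for i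
    by (rule nn_integral_cong_AE) (use assms(3) in auto)
  then show ?thesis using assms(2) s S sv by (intro has_bochner_intI[of M g s]) auto
qed

lemma has_bochner_int_cong:
  assumes "has_bochner_int M f v" "\<And>x. x \<in> space M \<Longrightarrow> f x = g x"
  shows "has_bochner_int M g v"
proof (rule has_bochner_int_cong_AE[OF assms(1)])
  have "strongly_measurable M f" using assms(1) by (simp add: has_bochner_int_def)
  then show "strongly_measurable M g" using assms(2) by (rule strongly_measurable_cong)
  show "AE x in M. f x = g x" using assms(2) by (rule AE_I2)
qed

lemma has_bochner_int_simple:
  "Bochner_Integration.simple_bochner_integrable M s \<Longrightarrow>
    has_bochner_int M (s :: _ \<Rightarrow> 'b::banach) (Bochner_Integration.simple_bochner_integral M s)"
  by (rule has_bochner_intI[where s="\<lambda>i. s"])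
    (auto intro: strongly_measurable_simple_bochner_integrable)

lemma has_bochner_int_dominated_convergence:
  fixes f :: "'a \<Rightarrow> 'b::banach"
  assumes F: "\<And>i. has_bochner_int M (F i) (v i)" and f: "strongly_measurable M f"
    and w: "w \<in> borel_measurable M" and bound: "\<And>i. AE x in M. norm (F i x) \<le> w x"
    and w_fin: "(\<integral>\<^sup>+x. w x \<partial>M) < \<infinity>" and lim: "AE x in M. (\<lambda>i. F i x) \<longlonglongrightarrow> f x"
  shows "has_bochner_int M f (bochner_int M f)" and "v \<longlonglongrightarrow> bochner_int M f"
proof -
  have "(\<integral>\<^sup>+ x. norm (f x) \<partial>M) \<le> (\<integral>\<^sup>+ x. w x \<partial>M)"
    using AE_norm_le_LIMSEQ[OF bound lim] by (intro nn_integral_mono_AE) (auto intro: ennreal_leI)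
  with w_fin show f_int: "has_bochner_int M f (bochner_int M f)"
    by (intro has_bochner_int_bochner_int f) simp
  have "ennreal (norm (v i - bochner_int M f)) \<le> (\<integral>\<^sup>+x. norm (f x - F i x) \<partial>M)" for i
    using has_bochner_int_norm_le[OF has_bochner_int_diff[OF F f_int]]
    by (simp add: norm_minus_commute)
  moreover have "(\<lambda>i. \<integral>\<^sup>+x. norm (f x - F i x) \<partial>M) \<longlonglongrightarrow> 0"
    using F by (intro nn_integral_dominated_convergence_norm_strongly[OF _ f w bound w_fin lim])
      (simp add: has_bochner_int_def)
  ultimately have "(\<lambda>i. ennreal (norm (v i - bochner_int M f))) \<longlonglongrightarrow> 0"
    by (rule ennreal_tendsto_0_le)
  then have "(\<lambda>i. norm (v i - bochner_int M f)) \<longlonglongrightarrow> 0"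
    by (simp flip: ennreal_0)
  then show "v \<longlonglongrightarrow> bochner_int M f"
    by (simp add: tendsto_norm_zero_iff LIM_zero_cancel)
qed

lemma has_bochner_int_scaleR_left:
  fixes \<phi> :: "'a \<Rightarrow> real" and c :: "'b::banach"
  assumes "has_bochner_integral M \<phi> I"
  shows "has_bochner_int M (\<lambda>x. \<phi> x *\<^sub>R c) (I *\<^sub>R c)"
proof -
  obtain s where \<phi>[measurable]: "\<phi> \<in> borel_measurable M"
    and s: "\<And>i. Bochner_Integration.simple_bochner_integrable M (s i)"
    and S: "(\<lambda>i. \<integral>\<^sup>+ x. norm (\<phi> x - s i x) \<partial>M) \<longlonglongrightarrow> 0"
    and sI: "(\<lambda>i. Bochner_Integration.simple_bochner_integral M (s i)) \<longlonglongrightarrow> I"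
    using assms by (elim has_bochner_integral.cases) blast
  have [measurable]: "s i \<in> borel_measurable M" for i
    using s by (auto elim: simple_bochner_integrable.cases intro: borel_measurable_simple_function)
  show ?thesis
  proof (rule has_bochner_intI)
    show "strongly_measurable M (\<lambda>x. \<phi> x *\<^sub>R c)"
      by (intro strongly_measurable_scaleR strongly_measurable_real strongly_measurable_const \<phi>)
    show "Bochner_Integration.simple_bochner_integrable M (\<lambda>x. s i x *\<^sub>R c)" for i
      using simple_bochner_integrable_compose2[of "\<lambda>a b. a *\<^sub>R c" M "s i" "s i"] s by auto
    have "Bochner_Integration.simple_bochner_integral M (\<lambda>x. s i x *\<^sub>R c) =
        Bochner_Integration.simple_bochner_integral M (s i) *\<^sub>R c" for i
      by (rule simple_bochner_integral_linear[OF _ s])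
        (simp add: bounded_linear.linear[OF bounded_linear_scaleR_left])
    then show "(\<lambda>i. Bochner_Integration.simple_bochner_integral M (\<lambda>x. s i x *\<^sub>R c)) \<longlonglongrightarrow> I *\<^sub>R c"
      using tendsto_scaleR[OF sI tendsto_const] by simp
    have "(\<integral>\<^sup>+ x. norm (\<phi> x *\<^sub>R c - s i x *\<^sub>R c) \<partial>M) =
        ennreal (norm c) * (\<integral>\<^sup>+ x. norm (\<phi> x - s i x) \<partial>M)" for i
    proof -
      have "(\<integral>\<^sup>+ x. norm (\<phi> x *\<^sub>R c - s i x *\<^sub>R c) \<partial>M) =
          (\<integral>\<^sup>+ x. ennreal (norm c) * ennreal (norm (\<phi> x - s i x)) \<partial>M)"
        by (intro nn_integral_cong)
          (simp add: ennreal_mult[symmetric] mult.commute flip: scaleR_diff_left)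
      also have "\<dots> = ennreal (norm c) * (\<integral>\<^sup>+ x. norm (\<phi> x - s i x) \<partial>M)"
        by (rule nn_integral_cmult) measurable
      finally show ?thesis .
    qed
    moreover have "(\<lambda>i. ennreal (norm c) * (\<integral>\<^sup>+ x. norm (\<phi> x - s i x) \<partial>M)) \<longlonglongrightarrow> ennreal (norm c) * 0"
      by (rule ennreal_tendsto_cmult[OF _ S]) simp
    ultimately show "(\<lambda>i. \<integral>\<^sup>+ x. norm (\<phi> x *\<^sub>R c - s i x *\<^sub>R c) \<partial>M) \<longlonglongrightarrow> 0" by simp
  qed
qed

lemma has_bochner_int_return:
  fixes g :: "'a \<Rightarrow> 'b::banach"
  assumes x: "x \<in> space M" and g: "strongly_measurable M g"
  shows "has_bochner_int (return M x) g (g x)"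
proof (rule has_bochner_intI[where s="\<lambda>i y. g x"])
  show "strongly_measurable (return M x) g"
    using g strongly_measurable_cong_sets[of "return M x" M g] by simp
  show "Bochner_Integration.simple_bochner_integrable (return M x) (\<lambda>y. g x)" for i :: nat
    by (rule simple_bochner_integrable_finite_measure)
      (simp_all add: prob_space.axioms(1)[OF prob_space_return[OF x]])
  have "(\<integral>\<^sup>+ y. ennreal (norm (g y - g x)) \<partial>return M x) = ennreal (norm (g x - g x))"
    by (rule nn_integral_return[OF x])
      (intro borel_measurable_ennreal_norm_strongly strongly_measurable_diff g
        strongly_measurable_const)
  then show "(\<lambda>i. \<integral>\<^sup>+ y. ennreal (norm (g y - g x)) \<partial>return M x) \<longlonglongrightarrow> 0" by simp
  have "space (return M x) \<noteq> {}" using x by auto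
  then show "(\<lambda>i. Bochner_Integration.simple_bochner_integral (return M x) (\<lambda>y. g x)) \<longlonglongrightarrow> g x"
    using x by (simp add: simple_bochner_integral_def image_constant_conv measure_return)
qed

section \<open>Jensen's inequality for powers and L^n norms\<close>

lemma tangent_line_le_power:
  fixes a t :: real
  assumes a: "0 \<le> a" and t: "0 \<le> t"
  shows "a ^ Suc k + real (Suc k) * a ^ k * (t - a) \<le> t ^ Suc k"
proof (induction k)
  case 0
  then show ?case by simp
next
  case (Suc k)
  have "t * (a ^ Suc k + real (Suc k) * a ^ k * (t - a))
      - (a ^ Suc (Suc k) + real (Suc (Suc k)) * a ^ Suc k * (t - a))
      = real (Suc k) * a ^ k * (t - a)\<^sup>2"
    by (simp add: algebra_simps power2_eq_square)
  moreover have "0 \<le> real (Suc k) * a ^ k * (t - a)\<^sup>2" using a by simp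
  moreover have "t * (a ^ Suc k + real (Suc k) * a ^ k * (t - a)) \<le> t * t ^ Suc k"
    using Suc t by (rule mult_left_mono)
  ultimately show ?case by simp
qed

lemma (in prob_space) nn_integral_less_top_of_power:
  fixes u :: "'a \<Rightarrow> real"
  assumes [measurable]: "u \<in> borel_measurable M" and nonneg: "\<And>x. 0 \<le> u x" and m: "1 \<le> m"
    and fin: "(\<integral>\<^sup>+ x. ennreal (u x ^ m) \<partial>M) < \<infinity>"
  shows "(\<integral>\<^sup>+ x. ennreal (u x) \<partial>M) < \<infinity>"
proof -
  have u_le: "u x \<le> 1 + u x ^ m" for x
  proof (cases "u x \<le> 1")
    case True
    then show ?thesis using zero_le_power[OF nonneg, of x m] by linarith
  next
    case False
    then have "u x \<le> u x ^ m" using m by (intro self_le_power) auto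
    then show ?thesis by simp
  qed
  have "ennreal (u x) \<le> ennreal 1 + ennreal (u x ^ m)" for x
  proof -
    have "ennreal (u x) \<le> ennreal (1 + u x ^ m)" by (rule ennreal_leI[OF u_le])
    also have "\<dots> = ennreal 1 + ennreal (u x ^ m)" using nonneg by (intro ennreal_plus) auto
    finally show ?thesis .
  qed
  then have "(\<integral>\<^sup>+ x. ennreal (u x) \<partial>M) \<le> (\<integral>\<^sup>+ x. ennreal 1 + ennreal (u x ^ m) \<partial>M)"
    by (intro nn_integral_mono)
  also have "\<dots> = 1 + (\<integral>\<^sup>+ x. ennreal (u x ^ m) \<partial>M)"
    by (subst nn_integral_add) (auto simp: emeasure_space_1)
  also have "\<dots> < \<infinity>" using fin by simp
  finally show ?thesis .
qed

lemma (in prob_space) nn_integral_power_le: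
  fixes u :: "'a \<Rightarrow> real"
  assumes [measurable]: "u \<in> borel_measurable M" and nonneg: "\<And>x. 0 \<le> u x" and m: "1 \<le> m"
  shows "(\<integral>\<^sup>+ x. ennreal (u x) \<partial>M) ^ m \<le> (\<integral>\<^sup>+ x. ennreal (u x ^ m) \<partial>M)"
proof (cases "(\<integral>\<^sup>+ x. ennreal (u x ^ m) \<partial>M) = \<infinity>")
  case False
  then have fin_m: "(\<integral>\<^sup>+ x. ennreal (u x ^ m) \<partial>M) < \<infinity>" by (simp add: less_top)
  obtain k where k: "m = Suc k" using m by (cases m) auto
  have int_m: "integrable M (\<lambda>x. u x ^ m)"
    using fin_m nonneg by (intro integrableI_nonneg) auto
  have int: "integrable M u"
    using nn_integral_less_top_of_power[OF _ nonneg m fin_m] nonneg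
    by (intro integrableI_nonneg) auto
  define a where "a = expectation u"
  have a: "0 \<le> a" unfolding a_def using nonneg by (simp add: integral_nonneg_AE)
  \<comment> \<open>Jensen's inequality, via the tangent line of the power function at the mean\<close>
  have "a ^ m = expectation (\<lambda>x. a ^ m + real m * a ^ (m - 1) * (u x - a))"
    using int by (simp add: a_def prob_space)
  also have "\<dots> \<le> expectation (\<lambda>x. u x ^ m)"
    using tangent_line_le_power[OF a nonneg, where k=k] int int_m k by (intro integral_mono) auto
  finally have "ennreal (a ^ m) \<le> ennreal (expectation (\<lambda>x. u x ^ m))" by (rule ennreal_leI)
  moreover have "(\<integral>\<^sup>+ x. ennreal (u x) \<partial>M) = ennreal a"
    unfolding a_def using int nonneg by (intro nn_integral_eq_integral) auto
  moreover have "(\<integral>\<^sup>+ x. ennreal (u x ^ m) \<partial>M) = ennreal (expectation (\<lambda>x. u x ^ m))"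
    using int_m nonneg by (intro nn_integral_eq_integral) auto
  ultimately show ?thesis using a by (simp add: ennreal_power)
qed simp

lemma Lnorm_cong_AE:
  assumes "AE x in M. f x = g x"
  shows "Lnorm M n f = Lnorm M n g"
proof -
  have "(\<integral>\<^sup>+ x. ennreal (norm (f x) ^ m) \<partial>M) = (\<integral>\<^sup>+ x. ennreal (norm (g x) ^ m) \<partial>M)" for m
    using assms by (intro nn_integral_cong_AE) auto
  moreover have "(AE x in M. ennreal (norm (f x)) \<le> C) \<longleftrightarrow> (AE x in M. ennreal (norm (g x)) \<le> C)"
    for C
  proof
    assume "AE x in M. ennreal (norm (f x)) \<le> C"
    with assms show "AE x in M. ennreal (norm (g x)) \<le> C" by eventually_elim simp
  next
    assume "AE x in M. ennreal (norm (g x)) \<le> C"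
    with assms show "AE x in M. ennreal (norm (f x)) \<le> C" by eventually_elim simp
  qed
  ultimately show ?thesis
    unfolding Lnorm_def by (simp split: enat.split)
qed

lemma Lnorm_enat_mono:
  assumes "(\<integral>\<^sup>+ x. ennreal (norm (f x) ^ m) \<partial>M) \<le> (\<integral>\<^sup>+ y. ennreal (norm (g y) ^ m) \<partial>N)"
  shows "Lnorm M (enat m) f \<le> Lnorm N (enat m) g"
  using assms unfolding Lnorm_def
  by (auto simp: Let_def top_unique less_top[symmetric]
      intro!: ennreal_leI powr_mono2 enn2real_mono)

lemma Lnorm_infinity_mono:
  assumes "\<And>C. AE y in N. ennreal (norm (g y)) \<le> C \<Longrightarrow> AE x in M. ennreal (norm (f x)) \<le> C"
  shows "Lnorm M \<infinity> f \<le> Lnorm N \<infinity> g"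
  unfolding Lnorm_def using assms by (auto intro!: Inf_superset_mono)

lemma (in prob_space) nn_integral_norm_less_top_of_Lnorm:
  fixes g :: "'a \<Rightarrow> 'v::real_normed_vector"
  assumes g: "strongly_measurable M g" and n: "n \<ge> 1" and fin: "Lnorm M n g < \<infinity>"
  shows "(\<integral>\<^sup>+ x. norm (g x) \<partial>M) < \<infinity>"
proof (cases n)
  case (enat m)
  have "(\<integral>\<^sup>+ x. ennreal (norm (g x) ^ m) \<partial>M) \<noteq> \<infinity>"
    using fin unfolding Lnorm_def enat by (auto simp: Let_def split: if_splits)
  moreover have "m \<ge> 1" using n enat by (simp add: one_enat_def)
  ultimately show ?thesis
    using nn_integral_less_top_of_power[OF borel_measurable_norm_strongly[OF g]]
    by (simp add: less_top)
next
  case infinity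
  then obtain C where C: "AE x in M. ennreal (norm (g x)) \<le> C" "C < \<infinity>"
    using fin unfolding Lnorm_def by (auto simp: Inf_less_iff)
  have "(\<integral>\<^sup>+ x. ennreal (norm (g x)) \<partial>M) \<le> (\<integral>\<^sup>+ x. C \<partial>M)"
    using C(1) by (rule nn_integral_mono_AE)
  also have "\<dots> = C" by (simp add: emeasure_space_1)
  finally show ?thesis using C(2) by (rule le_less_trans)
qed

lemma (in prob_space) nn_integral_norm_less_top_of_Lmem:
  fixes g :: "'a \<Rightarrow> 'v::real_normed_vector"
  shows "strongly_measurable M g \<Longrightarrow> Lmem M n g \<Longrightarrow> n \<ge> 1 \<Longrightarrow> (\<integral>\<^sup>+ x. norm (g x) \<partial>M) < \<infinity>"
  unfolding Lmem_def by (blast intro: nn_integral_norm_less_top_of_Lnorm)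

section \<open>Simple integrals against Markov kernels\<close>

lemma simple_function_level_set:
  assumes "simple_function M s"
  shows "{x \<in> space M. s x = v} \<in> sets M"
proof -
  have "{x \<in> space M. s x = v} = s -` {v} \<inter> space M" by auto
  then show ?thesis using simple_functionD(2)[OF assms] by simp
qed

lemma simple_bochner_integral_sets_eq:
  assumes "sets N = sets M"
  shows "Bochner_Integration.simple_bochner_integral N s =
    (\<Sum>v\<in>s ` space M. measure N {x \<in> space M. s x = v} *\<^sub>R v)"
  using sets_eq_imp_space_eq[OF assms] by (simp add: simple_bochner_integral_def)

lemma simple_bochner_integral_tendsto_bochner_int:
  fixes f :: "'a \<Rightarrow> 'b::banach"
  assumes sets: "sets N = sets M" and f: "strongly_measurable M f"
    and fin: "(\<integral>\<^sup>+x. norm (f x) \<partial>N) < \<infinity>"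
    and s: "\<And>i. simple_function M (s i)" "\<And>x. x \<in> space M \<Longrightarrow> (\<lambda>i. s i x) \<longlonglongrightarrow> f x"
      "\<And>i x. x \<in> space M \<Longrightarrow> norm (s i x) \<le> 2 * norm (f x)"
  shows "(\<lambda>i. Bochner_Integration.simple_bochner_integral N (s i)) \<longlonglongrightarrow> bochner_int N f"
proof (rule has_bochner_int_simple_approx(2)[OF _ fin])
  have space: "space N = space M" by (rule sets_eq_imp_space_eq[OF sets])
  show "strongly_measurable N f" using f strongly_measurable_cong_sets[OF sets] by blast
  show "simple_function N (s i)" for i
    using s(1) simple_function_cong_algebra[OF sets space] by blast
  show "x \<in> space N \<Longrightarrow> (\<lambda>i. s i x) \<longlonglongrightarrow> f x" for x using s(2) space by simp
  show "x \<in> space N \<Longrightarrow> norm (s i x) \<le> 2 * norm (f x)" for i x using s(3) space by simp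
qed

lemma strongly_measurable_simple_bochner_integral_kernel:
  fixes s :: "'b \<Rightarrow> 'v::real_normed_vector"
  assumes k: "k \<in> M \<rightarrow>\<^sub>M subprob_algebra Q" and s: "simple_function Q s"
  shows "strongly_measurable M (\<lambda>x. Bochner_Integration.simple_bochner_integral (k x) s)"
proof (rule strongly_measurable_cong)
  show "strongly_measurable M (\<lambda>x. \<Sum>v\<in>s ` space Q. measure (k x) {y \<in> space Q. s y = v} *\<^sub>R v)"
    by (intro strongly_measurable_sum strongly_measurable_scaleR strongly_measurable_real
        strongly_measurable_const simple_functionD(1)[OF s]
        measurable_compose[OF k measurable_measure_subprob_algebra] simple_function_level_set[OF s])
  show "(\<Sum>v\<in>s ` space Q. measure (k x) {y \<in> space Q. s y = v} *\<^sub>R v) =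
      Bochner_Integration.simple_bochner_integral (k x) s" if "x \<in> space M" for x
    using measurable_space[OF k that]
    by (simp add: simple_bochner_integral_sets_eq[of "k x" Q] space_subprob_algebra)
qed

lemma has_bochner_integral_measure_bind:
  assumes A: "A \<in> space (prob_algebra Q)" and l: "l \<in> Q \<rightarrow>\<^sub>M prob_algebra R" and S: "S \<in> sets R"
  shows "has_bochner_integral A (\<lambda>y. measure (l y) S) (measure (A \<bind> l) S)"
proof -
  have sets_A: "sets A = sets Q" and A_prob: "prob_space A"
    using A by (auto simp: space_prob_algebra)
  have l_A: "l \<in> A \<rightarrow>\<^sub>M prob_algebra R"
    using l measurable_cong_sets[OF sets_A refl] by blast
  have l_y: "prob_space (l y)" if "y \<in> space A" for y
    using measurable_space[OF l_A that] by (simp add: space_prob_algebra)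
  have meas: "(\<lambda>y. measure (l y) S) \<in> borel_measurable A"
    using l_A S by measurable
  have int: "integrable A (\<lambda>y. measure (l y) S)"
    using l_y prob_space.prob_le_1
    by (intro finite_measure.integrable_const_bound[OF prob_space.finite_measure[OF A_prob] _ meas,
        where B=1] AE_I2) auto
  have "emeasure (A \<bind> l) S = (\<integral>\<^sup>+y. emeasure (l y) S \<partial>A)"
    by (rule emeasure_bind_prob_algebra[OF A l S])
  also have "\<dots> = (\<integral>\<^sup>+y. ennreal (measure (l y) S) \<partial>A)"
    using l_y by (intro nn_integral_cong)
      (simp add: finite_measure.emeasure_eq_measure prob_space.finite_measure)
  also have "\<dots> = ennreal (integral\<^sup>L A (\<lambda>y. measure (l y) S))"
    using int by (intro nn_integral_eq_integral) auto
  finally have "measure (A \<bind> l) S = integral\<^sup>L A (\<lambda>y. measure (l y) S)"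
    by (simp add: measure_def integral_nonneg_AE)
  then show ?thesis
    using has_bochner_integral_integrable[OF int] by simp
qed

lemma has_bochner_int_simple_bochner_integral_bind:
  fixes s :: "'c \<Rightarrow> 'v::banach"
  assumes A: "A \<in> space (prob_algebra Q)" and l: "l \<in> Q \<rightarrow>\<^sub>M prob_algebra R"
    and s: "simple_function R s"
  shows "has_bochner_int A (\<lambda>y. Bochner_Integration.simple_bochner_integral (l y) s)
      (Bochner_Integration.simple_bochner_integral (A \<bind> l) s)"
proof -
  have "has_bochner_int A (\<lambda>y. \<Sum>v\<in>s ` space R. measure (l y) {z \<in> space R. s z = v} *\<^sub>R v)
      (\<Sum>v\<in>s ` space R. measure (A \<bind> l) {z \<in> space R. s z = v} *\<^sub>R v)"
    by (intro has_bochner_int_sum has_bochner_int_scaleR_left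
        has_bochner_integral_measure_bind[OF A l] simple_function_level_set[OF s]
        simple_functionD(1)[OF s])
  moreover have "(\<Sum>v\<in>s ` space R. measure (l y) {z \<in> space R. s z = v} *\<^sub>R v) =
      Bochner_Integration.simple_bochner_integral (l y) s" if "y \<in> space A" for y
    using A measurable_space[OF l, of y] that sets_eq_imp_space_eq[of A Q]
    by (intro simple_bochner_integral_sets_eq[symmetric]) (simp add: space_prob_algebra)
  ultimately show ?thesis
    unfolding simple_bochner_integral_sets_eq[OF sets_bind'[OF A l]]
    by (rule has_bochner_int_cong)
qed

lemma norm_simple_bochner_integral_le:
  fixes s :: "'a \<Rightarrow> 'b::banach"
  assumes N: "finite_measure N" and sets: "sets N = sets M" and s: "simple_function M s"
    and bound: "\<And>x. x \<in> space M \<Longrightarrow> norm (s x) \<le> w x"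
  shows "ennreal (norm (Bochner_Integration.simple_bochner_integral N s)) \<le> (\<integral>\<^sup>+x. w x \<partial>N)"
proof -
  have space: "space N = space M" by (rule sets_eq_imp_space_eq[OF sets])
  have "Bochner_Integration.simple_bochner_integrable N s"
    using s simple_function_cong_algebra[OF sets space]
    by (intro simple_bochner_integrable_finite_measure N) blast
  then have "ennreal (norm (Bochner_Integration.simple_bochner_integral N s)) \<le>
      (\<integral>\<^sup>+x. norm (s x) \<partial>N)"
    by (intro has_bochner_int_norm_le has_bochner_int_simple)
  also have "\<dots> \<le> (\<integral>\<^sup>+x. w x \<partial>N)"
    using bound by (intro nn_integral_mono ennreal_leI) (simp add: space)
  finally show ?thesis .
qed

lemma tendsto_simple_bochner_integral_bind:
  fixes g :: "'c \<Rightarrow> 'v::banach"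
  assumes A: "A \<in> space (prob_algebra Q)" and l: "l \<in> Q \<rightarrow>\<^sub>M prob_algebra R"
    and g: "strongly_measurable R g" and fin: "(\<integral>\<^sup>+y. (\<integral>\<^sup>+z. norm (g z) \<partial>l y) \<partial>A) < \<infinity>"
    and h: "strongly_measurable Q h" and h_eq: "AE y in A. h y = bochner_int (l y) g"
    and s: "\<And>i. simple_function R (s i)" "\<And>z. z \<in> space R \<Longrightarrow> (\<lambda>i. s i z) \<longlonglongrightarrow> g z"
      "\<And>i z. z \<in> space R \<Longrightarrow> norm (s i z) \<le> 2 * norm (g z)"
  shows "(\<lambda>i. Bochner_Integration.simple_bochner_integral (A \<bind> l) (s i)) \<longlonglongrightarrow> bochner_int A h"
proof -
  define G where "G y = (\<integral>\<^sup>+z. norm (g z) \<partial>l y)" for y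
  have sets_A: "sets A = sets Q" using A by (simp add: space_prob_algebra)
  have l_A: "l \<in> A \<rightarrow>\<^sub>M prob_algebra R"
    using l measurable_cong_sets[OF sets_A refl] by blast
  have l_y: "prob_space (l y)" "sets (l y) = sets R" if "y \<in> space A" for y
    using measurable_space[OF l_A that] by (simp_all add: space_prob_algebra)
  have G[measurable]: "G \<in> borel_measurable A"
    unfolding G_def
    using measurable_prob_algebraD[OF l_A] borel_measurable_ennreal_norm_strongly[OF g]
    by measurable
  have fin_G: "(\<integral>\<^sup>+y. G y \<partial>A) < \<infinity>" using fin by (simp add: G_def)
  then have G_fin: "AE y in A. G y < \<infinity>"
    using nn_integral_PInf_AE[OF G] by (simp add: less_top)
  show ?thesis
  proof (rule has_bochner_int_dominated_convergence(2))
    show "has_bochner_int A (\<lambda>y. Bochner_Integration.simple_bochner_integral (l y) (s i))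
        (Bochner_Integration.simple_bochner_integral (A \<bind> l) (s i))" for i
      by (rule has_bochner_int_simple_bochner_integral_bind[OF A l s(1)])
    show "strongly_measurable A h" using h strongly_measurable_cong_sets[OF sets_A] by blast
    show "(\<lambda>y. 2 * enn2real (G y)) \<in> borel_measurable A" by measurable
    have "(\<integral>\<^sup>+y. ennreal (2 * enn2real (G y)) \<partial>A) \<le> (\<integral>\<^sup>+y. 2 * G y \<partial>A)"
      by (intro nn_integral_mono) (simp add: ennreal_mult ennreal_enn2real_if)
    also have "\<dots> < \<infinity>"
      using fin_G by (simp add: nn_integral_cmult ennreal_mult_less_top)
    finally show "(\<integral>\<^sup>+y. ennreal (2 * enn2real (G y)) \<partial>A) < \<infinity>" .
    show "AE y in A. norm (Bochner_Integration.simple_bochner_integral (l y) (s i)) \<le>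
        2 * enn2real (G y)" for i
      using G_fin AE_space
    proof eventually_elim
      case (elim y)
      have "ennreal (norm (Bochner_Integration.simple_bochner_integral (l y) (s i))) \<le>
          (\<integral>\<^sup>+z. ennreal (2 * norm (g z)) \<partial>l y)"
        using l_y(1)[OF elim(2)] s(3)
        by (intro norm_simple_bochner_integral_le[OF _ l_y(2)[OF elim(2)] s(1)])
          (auto simp: prob_space.finite_measure)
      also have "\<dots> = ennreal (2 * enn2real (G y))"
        using elim(1) borel_measurable_ennreal_norm_strongly[OF g]
        by (simp add: G_def ennreal_mult nn_integral_cmult ennreal_enn2real_if less_top[symmetric]
            measurable_cong_sets[OF l_y(2)[OF elim(2)]])
      finally show ?case by simp
    qed
    show "AE y in A. (\<lambda>i. Bochner_Integration.simple_bochner_integral (l y) (s i)) \<longlonglongrightarrow> h y"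
      using G_fin h_eq AE_space
    proof eventually_elim
      case (elim y)
      then show ?case
        using simple_bochner_integral_tendsto_bochner_int[OF l_y(2)[OF elim(3)] g _ s]
        by (simp add: G_def)
    qed
  qed
qed

lemma bochner_int_bind:
  fixes g :: "'c \<Rightarrow> 'v::banach"
  assumes A: "A \<in> space (prob_algebra Q)" and l: "l \<in> Q \<rightarrow>\<^sub>M prob_algebra R"
    and g: "strongly_measurable R g" and fin: "(\<integral>\<^sup>+y. (\<integral>\<^sup>+z. norm (g z) \<partial>l y) \<partial>A) < \<infinity>"
    and h: "strongly_measurable Q h" and h_eq: "AE y in A. h y = bochner_int (l y) g"
  shows "bochner_int (A \<bind> l) g = bochner_int A h"
proof -
  obtain s where s: "\<And>i. simple_function R (s i)" "\<And>z. z \<in> space R \<Longrightarrow> (\<lambda>i. s i z) \<longlonglongrightarrow> g z"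
      "\<And>i z. z \<in> space R \<Longrightarrow> norm (s i z) \<le> 2 * norm (g z)"
    using strongly_measurable_simple_approx[OF g] by metis
  have "sets A = sets Q" using A by (simp add: space_prob_algebra)
  then have "l \<in> A \<rightarrow>\<^sub>M subprob_algebra R"
    using measurable_prob_algebraD[OF l] measurable_cong_sets[of A Q] by blast
  then have "(\<integral>\<^sup>+z. norm (g z) \<partial>(A \<bind> l)) = (\<integral>\<^sup>+y. (\<integral>\<^sup>+z. norm (g z) \<partial>l y) \<partial>A)"
    by (rule nn_integral_bind[OF borel_measurable_ennreal_norm_strongly[OF g]])
  then have "(\<lambda>i. Bochner_Integration.simple_bochner_integral (A \<bind> l) (s i)) \<longlonglongrightarrow>
      bochner_int (A \<bind> l) g"
    using fin
    by (intro simple_bochner_integral_tendsto_bochner_int[OF sets_bind'[OF A l] g _ s]) simp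
  moreover have "(\<lambda>i. Bochner_Integration.simple_bochner_integral (A \<bind> l) (s i)) \<longlonglongrightarrow>
      bochner_int A h"
    by (rule tendsto_simple_bochner_integral_bind[OF A l g fin h h_eq s])
  ultimately show ?thesis by (rule LIMSEQ_unique)
qed

section \<open>Pullback along a measure-preserving kernel\<close>

lemma kstar_return:
  fixes g :: "'a \<Rightarrow> 'v::banach"
  shows "x \<in> space M \<Longrightarrow> strongly_measurable M g \<Longrightarrow> kstar (return M) g x = g x"
  unfolding kstar_def by (rule bochner_int_eqI[OF has_bochner_int_return])

locale measure_preserving_kernel =
  fixes p :: "'a measure" and q :: "'b measure" and k :: "'a \<Rightarrow> 'b measure"
  assumes mp_kernel: "mp_kernel p q k"
begin

lemma kernel_measurable: "k \<in> p \<rightarrow>\<^sub>M prob_algebra q"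
  using mp_kernel by (simp add: mp_kernel_def)

lemma prob_space_source: "prob_space p"
  using mp_kernel by (simp add: mp_kernel_def)

lemma bind_kernel: "p \<bind> k = q"
  using mp_kernel by (simp add: mp_kernel_def)

lemma kernel_space: "x \<in> space p \<Longrightarrow> k x \<in> space (prob_algebra q)"
  by (rule measurable_space[OF kernel_measurable])

lemma prob_space_kernel: "x \<in> space p \<Longrightarrow> prob_space (k x)"
  using kernel_space by (simp add: space_prob_algebra)

lemma sets_kernel: "x \<in> space p \<Longrightarrow> sets (k x) = sets q"
  using kernel_space by (simp add: space_prob_algebra)

lemma strongly_measurable_kernel:
  "x \<in> space p \<Longrightarrow> strongly_measurable q g \<Longrightarrow> strongly_measurable (k x) g"
  using strongly_measurable_cong_sets[OF sets_kernel] by blast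

lemma prob_space_target: "prob_space q"
proof -
  have "prob_space (p \<bind> k)"
    by (rule prob_space.prob_space_bind[OF prob_space_source _
          measurable_prob_algebraD[OF kernel_measurable]])
      (intro AE_I2 prob_space_kernel)
  then show ?thesis by (simp add: bind_kernel)
qed

lemma measurable_nn_integral_kernel:
  "f \<in> borel_measurable q \<Longrightarrow> (\<lambda>x. \<integral>\<^sup>+y. f y \<partial>k x) \<in> borel_measurable p"
  by (rule measurable_compose[OF measurable_prob_algebraD[OF kernel_measurable]
        nn_integral_measurable_subprob_algebra])

lemma nn_integral_kernel:
  "f \<in> borel_measurable q \<Longrightarrow> (\<integral>\<^sup>+x. (\<integral>\<^sup>+y. f y \<partial>k x) \<partial>p) = (\<integral>\<^sup>+y. f y \<partial>q)"
  using nn_integral_bind[OF _ measurable_prob_algebraD[OF kernel_measurable]]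
  by (simp add: bind_kernel)

lemma AE_nn_integral_kernel_less_top:
  assumes f: "f \<in> borel_measurable q" and fin: "(\<integral>\<^sup>+y. f y \<partial>q) < \<infinity>"
  shows "AE x in p. (\<integral>\<^sup>+y. f y \<partial>k x) < \<infinity>"
proof -
  have "(\<integral>\<^sup>+x. (\<integral>\<^sup>+y. f y \<partial>k x) \<partial>p) \<noteq> \<infinity>"
    using fin by (simp add: nn_integral_kernel[OF f])
  from nn_integral_PInf_AE[OF measurable_nn_integral_kernel[OF f] this] show ?thesis
    by (simp add: less_top)
qed

lemma AE_kernel:
  assumes "AE y in q. P y"
  shows "AE x in p. AE y in k x. P y"
proof -
  obtain N where N: "{y \<in> space q. \<not> P y} \<subseteq> N" "emeasure q N = 0" "N \<in> sets q"
    using assms by (rule AE_E)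
  have "emeasure q N = (\<integral>\<^sup>+x. emeasure (k x) N \<partial>p)"
    unfolding bind_kernel[symmetric]
    by (rule emeasure_bind[OF prob_space.not_empty[OF prob_space_source]
          measurable_prob_algebraD[OF kernel_measurable] N(3)])
  then have "AE x in p. emeasure (k x) N = 0"
    using N(2) measurable_emeasure_subprob_algebra[OF N(3)]
      measurable_prob_algebraD[OF kernel_measurable]
    by (subst nn_integral_0_iff_AE[symmetric]) auto
  then show ?thesis
    using AE_space
  proof eventually_elim
    case (elim x)
    then show ?case
      using N(1,3) sets_kernel[OF elim(2)] sets_eq_imp_space_eq[OF sets_kernel[OF elim(2)]]
      by (intro AE_I[of _ _ N]) auto
  qed
qed

lemma AE_has_bochner_int_kstar:
  fixes g :: "'b \<Rightarrow> 'v::banach"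
  assumes g: "strongly_measurable q g" and fin: "(\<integral>\<^sup>+y. norm (g y) \<partial>q) < \<infinity>"
  shows "AE x in p. has_bochner_int (k x) g (kstar k g x)"
  using AE_nn_integral_kernel_less_top[OF borel_measurable_ennreal_norm_strongly[OF g] fin] AE_space
proof eventually_elim
  case (elim x)
  then show ?case
    unfolding kstar_def by (intro has_bochner_int_bochner_int strongly_measurable_kernel g)
qed

lemma ae_strongly_measurable_kstar:
  fixes g :: "'b \<Rightarrow> 'v::banach"
  assumes g: "strongly_measurable q g" and fin: "(\<integral>\<^sup>+y. norm (g y) \<partial>q) < \<infinity>"
  shows "ae_strongly_measurable p (kstar k g)"
proof -
  obtain s where s: "\<And>i. simple_function q (s i)" "\<And>y. y \<in> space q \<Longrightarrow> (\<lambda>i. s i y) \<longlonglongrightarrow> g y"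
      "\<And>i y. y \<in> space q \<Longrightarrow> norm (s i y) \<le> 2 * norm (g y)"
    using strongly_measurable_simple_approx[OF g] by metis
  define C where "C = {x \<in> space p. (\<integral>\<^sup>+y. norm (g y) \<partial>k x) < \<infinity>}"
  have C: "C \<in> sets p"
    using measurable_nn_integral_kernel[OF borel_measurable_ennreal_norm_strongly[OF g]]
    unfolding C_def by measurable
  have "strongly_measurable p (\<lambda>x. indicator C x *\<^sub>R kstar k g x)"
  proof (rule strongly_measurable_LIMSEQ)
    show "strongly_measurable p
        (\<lambda>x. indicator C x *\<^sub>R Bochner_Integration.simple_bochner_integral (k x) (s i))" for i
      by (intro strongly_measurable_scaleR strongly_measurable_real borel_measurable_indicator C
          strongly_measurable_simple_bochner_integral_kernel[OF
            measurable_prob_algebraD[OF kernel_measurable] s(1)])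
    show "(\<lambda>i. indicator C x *\<^sub>R Bochner_Integration.simple_bochner_integral (k x) (s i))
        \<longlonglongrightarrow> indicator C x *\<^sub>R kstar k g x" for x
    proof (cases "x \<in> C")
      case True
      then have "(\<lambda>i. Bochner_Integration.simple_bochner_integral (k x) (s i)) \<longlonglongrightarrow> kstar k g x"
        unfolding kstar_def C_def
        by (intro simple_bochner_integral_tendsto_bochner_int[OF sets_kernel g _ s]) auto
      then show ?thesis by (intro tendsto_scaleR tendsto_const)
    qed simp
  qed
  moreover have "AE x in p. kstar k g x = indicator C x *\<^sub>R kstar k g x"
    using AE_nn_integral_kernel_less_top[OF borel_measurable_ennreal_norm_strongly[OF g] fin]
      AE_space
    by eventually_elim (simp add: C_def)
  ultimately show ?thesis
    unfolding ae_strongly_measurable_def by blast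
qed

lemma AE_norm_kstar_le:
  fixes g :: "'b \<Rightarrow> 'v::banach"
  assumes g: "strongly_measurable q g" and fin: "(\<integral>\<^sup>+y. norm (g y) \<partial>q) < \<infinity>"
  shows "AE x in p. ennreal (norm (kstar k g x)) \<le> (\<integral>\<^sup>+y. norm (g y) \<partial>k x)"
  using AE_has_bochner_int_kstar[OF g fin] by eventually_elim (rule has_bochner_int_norm_le)

lemma nn_integral_power_kstar_le:
  fixes g :: "'b \<Rightarrow> 'v::banach"
  assumes g: "strongly_measurable q g" and fin: "(\<integral>\<^sup>+y. norm (g y) \<partial>q) < \<infinity>" and m: "1 \<le> m"
  shows "(\<integral>\<^sup>+x. ennreal (norm (kstar k g x) ^ m) \<partial>p) \<le> (\<integral>\<^sup>+y. ennreal (norm (g y) ^ m) \<partial>q)"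
proof -
  have [measurable]: "(\<lambda>y. norm (g y)) \<in> borel_measurable q"
    by (rule borel_measurable_norm_strongly[OF g])
  have "AE x in p. ennreal (norm (kstar k g x) ^ m) \<le> (\<integral>\<^sup>+y. ennreal (norm (g y) ^ m) \<partial>k x)"
    using AE_norm_kstar_le[OF g fin] AE_space
  proof eventually_elim
    case (elim x)
    have "ennreal (norm (kstar k g x) ^ m) = ennreal (norm (kstar k g x)) ^ m"
      by (simp add: ennreal_power)
    also have "\<dots> \<le> (\<integral>\<^sup>+y. norm (g y) \<partial>k x) ^ m"
      using elim(1) by (rule power_mono) simp
    also have "\<dots> \<le> (\<integral>\<^sup>+y. ennreal (norm (g y) ^ m) \<partial>k x)"
      by (intro prob_space.nn_integral_power_le prob_space_kernel elim m
          borel_measurable_norm_strongly strongly_measurable_kernel g) simp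
    finally show ?case .
  qed
  then have "(\<integral>\<^sup>+x. ennreal (norm (kstar k g x) ^ m) \<partial>p) \<le>
      (\<integral>\<^sup>+x. (\<integral>\<^sup>+y. ennreal (norm (g y) ^ m) \<partial>k x) \<partial>p)"
    by (rule nn_integral_mono_AE)
  also have "\<dots> = (\<integral>\<^sup>+y. ennreal (norm (g y) ^ m) \<partial>q)"
    by (rule nn_integral_kernel) measurable
  finally show ?thesis .
qed

lemma AE_norm_kstar_le_AE_bound:
  fixes g :: "'b \<Rightarrow> 'v::banach"
  assumes g: "strongly_measurable q g" and fin: "(\<integral>\<^sup>+y. norm (g y) \<partial>q) < \<infinity>"
    and bound: "AE y in q. ennreal (norm (g y)) \<le> C"
  shows "AE x in p. ennreal (norm (kstar k g x)) \<le> C"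
  using AE_kernel[OF bound] AE_norm_kstar_le[OF g fin] AE_space
proof eventually_elim
  case (elim x)
  note elim(2)
  also have "(\<integral>\<^sup>+y. norm (g y) \<partial>k x) \<le> (\<integral>\<^sup>+y. C \<partial>k x)"
    using elim(1) by (rule nn_integral_mono_AE)
  also have "\<dots> = C"
    using prob_space.emeasure_space_1[OF prob_space_kernel[OF elim(3)]] by simp
  finally show ?case .
qed

lemma Lnorm_kstar_le:
  fixes g :: "'b \<Rightarrow> 'v::banach"
  assumes g: "strongly_measurable q g" and fin: "(\<integral>\<^sup>+y. norm (g y) \<partial>q) < \<infinity>" and n: "n \<ge> 1"
  shows "Lnorm p n (kstar k g) \<le> Lnorm q n g"
proof (cases n)
  case (enat m)
  with n have "1 \<le> m" by (simp add: one_enat_def)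
  then show ?thesis
    unfolding enat by (intro Lnorm_enat_mono nn_integral_power_kstar_le g fin)
next
  case infinity
  then show ?thesis
    using AE_norm_kstar_le_AE_bound[OF g fin] by (simp add: Lnorm_infinity_mono)
qed

lemma AE_bochner_integrable_kernel:
  fixes g :: "'b \<Rightarrow> 'v::banach"
  assumes g: "strongly_measurable q g" and fin: "(\<integral>\<^sup>+y. norm (g y) \<partial>q) < \<infinity>"
  shows "AE x in p. bochner_integrable (k x) g"
  using AE_has_bochner_int_kstar[OF g fin] by eventually_elim (auto simp: bochner_integrable_def)

lemma Lmem_kstar:
  fixes g :: "'b \<Rightarrow> 'v::banach"
  assumes g: "strongly_measurable q g" and fin: "(\<integral>\<^sup>+y. norm (g y) \<partial>q) < \<infinity>"
    and n: "n \<ge> 1" and "Lmem q n g"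
  shows "Lmem p n (kstar k g)"
  using ae_strongly_measurable_kstar[OF g fin] Lnorm_kstar_le[OF g fin n] assms(4)
  unfolding Lmem_def by (blast intro: le_less_trans)

lemma AE_kstar_cong:
  fixes g g' :: "'b \<Rightarrow> 'v::banach"
  assumes g: "strongly_measurable q g" and g': "strongly_measurable q g'"
    and fin: "(\<integral>\<^sup>+y. norm (g y) \<partial>q) < \<infinity>" and eq: "AE y in q. g y = g' y"
  shows "AE x in p. kstar k g x = kstar k g' x"
  using AE_has_bochner_int_kstar[OF g fin] AE_kernel[OF eq] AE_space
proof eventually_elim
  case (elim x)
  have "has_bochner_int (k x) g' (kstar k g x)"
    by (rule has_bochner_int_cong_AE[OF elim(1) strongly_measurable_kernel[OF elim(3) g'] elim(2)])
  then have "bochner_int (k x) g' = kstar k g x" by (rule bochner_int_eqI)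
  then show ?case by (simp add: kstar_def)
qed

lemma AE_kstar_linear:
  fixes g h :: "'b \<Rightarrow> 'v::banach"
  assumes g: "strongly_measurable q g" "(\<integral>\<^sup>+y. norm (g y) \<partial>q) < \<infinity>"
    and h: "strongly_measurable q h" "(\<integral>\<^sup>+y. norm (h y) \<partial>q) < \<infinity>"
  shows "AE x in p. kstar k (\<lambda>y. a *\<^sub>R g y + b *\<^sub>R h y) x = a *\<^sub>R kstar k g x + b *\<^sub>R kstar k h x"
  using AE_has_bochner_int_kstar[OF g] AE_has_bochner_int_kstar[OF h]
proof eventually_elim
  case (elim x)
  have "has_bochner_int (k x) (\<lambda>y. a *\<^sub>R g y + b *\<^sub>R h y) (a *\<^sub>R kstar k g x + b *\<^sub>R kstar k h x)"
    by (intro has_bochner_int_add has_bochner_int_scaleR_right elim)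
  then show ?case unfolding kstar_def[of k "\<lambda>y. a *\<^sub>R g y + b *\<^sub>R h y"] by (rule bochner_int_eqI)
qed

lemma Lnorm_kstar_diff_le:
  fixes g h :: "'b \<Rightarrow> 'v::banach"
  assumes g: "strongly_measurable q g" "(\<integral>\<^sup>+y. norm (g y) \<partial>q) < \<infinity>"
    and h: "strongly_measurable q h" "(\<integral>\<^sup>+y. norm (h y) \<partial>q) < \<infinity>" and n: "n \<ge> 1"
  shows "Lnorm p n (\<lambda>x. kstar k g x - kstar k h x) \<le> Lnorm q n (\<lambda>y. g y - h y)"
proof -
  have "AE x in p. kstar k g x - kstar k h x = kstar k (\<lambda>y. g y - h y) x"
    using AE_kstar_linear[OF g h, of 1 "-1"] by eventually_elim simp
  then have "Lnorm p n (\<lambda>x. kstar k g x - kstar k h x) = Lnorm p n (kstar k (\<lambda>y. g y - h y))"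
    by (rule Lnorm_cong_AE)
  also have "\<dots> \<le> Lnorm q n (\<lambda>y. g y - h y)"
  proof (rule Lnorm_kstar_le[OF strongly_measurable_diff[OF g(1) h(1)] _ n])
    have "(\<integral>\<^sup>+y. norm (g y - h y) \<partial>q) \<le> (\<integral>\<^sup>+y. ennreal (norm (g y)) + ennreal (norm (h y)) \<partial>q)"
      by (intro nn_integral_mono) (simp add: norm_triangle_ineq4 flip: ennreal_plus)
    also have "\<dots> = (\<integral>\<^sup>+y. norm (g y) \<partial>q) + (\<integral>\<^sup>+y. norm (h y) \<partial>q)"
      by (intro nn_integral_add borel_measurable_ennreal_norm_strongly g(1) h(1))
    also have "\<dots> < \<infinity>" using g(2) h(2) by simp
    finally show "(\<integral>\<^sup>+y. norm (g y - h y) \<partial>q) < \<infinity>" .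
  qed
  finally show ?thesis .
qed

lemma AE_kstar_bind:
  fixes g :: "'c \<Rightarrow> 'v::banach"
  assumes l: "mp_kernel q r l" and g: "strongly_measurable r g"
    and fin: "(\<integral>\<^sup>+z. norm (g z) \<partial>r) < \<infinity>"
    and h: "strongly_measurable q h" and h_eq: "AE y in q. h y = kstar l g y"
  shows "AE x in p. kstar (\<lambda>x. k x \<bind> l) g x = kstar k h x"
proof -
  interpret L: measure_preserving_kernel q r l by (rule measure_preserving_kernel.intro[OF l])
  have G: "(\<lambda>y. \<integral>\<^sup>+z. norm (g z) \<partial>l y) \<in> borel_measurable q"
    by (rule L.measurable_nn_integral_kernel[OF borel_measurable_ennreal_norm_strongly[OF g]])
  have "(\<integral>\<^sup>+y. (\<integral>\<^sup>+z. norm (g z) \<partial>l y) \<partial>q) < \<infinity>"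
    using fin by (simp add: L.nn_integral_kernel[OF borel_measurable_ennreal_norm_strongly[OF g]])
  with G have "AE x in p. (\<integral>\<^sup>+y. (\<integral>\<^sup>+z. norm (g z) \<partial>l y) \<partial>k x) < \<infinity>"
    by (rule AE_nn_integral_kernel_less_top)
  moreover have "AE x in p. AE y in k x. h y = bochner_int (l y) g"
    using AE_kernel[OF h_eq] by (simp add: kstar_def)
  ultimately show ?thesis
    using AE_space
  proof eventually_elim
    case (elim x)
    show ?case
      unfolding kstar_def
      by (rule bochner_int_bind[OF kernel_space[OF elim(3)] L.kernel_measurable g elim(1) h
            elim(2)])
  qed
qed

end

theorem proposition7p5:
  fixes p :: "'a measure" and q :: "'b measure" and r :: "'c measure"
    and k :: "'a \<Rightarrow> 'b measure" and n :: enat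
  assumes k: "mp_kernel p q k"
    and n: "n \<ge> 1"
  shows
    "(\<forall>g :: 'b \<Rightarrow> 'v::banach. strongly_measurable q g \<and> Lmem q n g \<longrightarrow>
        (AE x in p. bochner_integrable (k x) g) \<and> Lmem p n (kstar k g))
   \<and> (\<forall>g g' :: 'b \<Rightarrow> 'v. strongly_measurable q g \<and> strongly_measurable q g' \<and> Lmem q n g
        \<and> (AE y in q. g y = g' y) \<longrightarrow> (AE x in p. kstar k g x = kstar k g' x))
   \<and> (\<forall>(a::real) (b::real) (g :: 'b \<Rightarrow> 'v) h. strongly_measurable q g \<and> strongly_measurable q h
        \<and> Lmem q n g \<and> Lmem q n h \<longrightarrow>
        (AE x in p. kstar k (\<lambda>y. a *\<^sub>R g y + b *\<^sub>R h y) x = a *\<^sub>R kstar k g x + b *\<^sub>R kstar k h x))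
   \<and> (\<forall>(g :: 'b \<Rightarrow> 'v) h. strongly_measurable q g \<and> strongly_measurable q h
        \<and> Lmem q n g \<and> Lmem q n h \<longrightarrow>
        Lnorm p n (\<lambda>x. kstar k g x - kstar k h x) \<le> Lnorm q n (\<lambda>y. g y - h y))
   \<and> (\<forall>g :: 'a \<Rightarrow> 'v. strongly_measurable p g \<and> Lmem p n g \<longrightarrow>
        (AE x in p. kstar (return p) g x = g x))
   \<and> (\<forall>(l :: 'b \<Rightarrow> 'c measure) (g :: 'c \<Rightarrow> 'v) h. mp_kernel q r l \<and> strongly_measurable r g
        \<and> Lmem r n g \<and> strongly_measurable q h \<and> (AE y in q. h y = kstar l g y) \<longrightarrow>
        (AE x in p. kstar (\<lambda>x. bind (k x) l) g x = kstar k h x))"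
proof -
  interpret measure_preserving_kernel p q k by (rule measure_preserving_kernel.intro[OF k])
  note L1 = prob_space.nn_integral_norm_less_top_of_Lmem[OF prob_space_target _ _ n]
  have bind: "AE x in p. kstar (\<lambda>x. k x \<bind> l) g x = kstar k h x"
    if l: "mp_kernel q r l" and g: "strongly_measurable r g" "Lmem r n g"
      and h: "strongly_measurable q h" "AE y in q. h y = kstar l g y"
    for l :: "'b \<Rightarrow> 'c measure" and g :: "'c \<Rightarrow> 'v" and h
  proof -
    interpret L: measure_preserving_kernel q r l by (rule measure_preserving_kernel.intro[OF l])
    show ?thesis
      by (rule AE_kstar_bind[OF l g(1)
            prob_space.nn_integral_norm_less_top_of_Lmem[OF L.prob_space_target g n] h])
  qed
  have return: "AE x in p. kstar (return p) g x = g x" if "strongly_measurable p g"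
    for g :: "'a \<Rightarrow> 'v"
    by (intro AE_I2 kstar_return that)
  show ?thesis
    using AE_bochner_integrable_kernel[OF _ L1] Lmem_kstar[OF _ L1 n] AE_kstar_cong[OF _ _ L1]
      AE_kstar_linear[OF _ L1 _ L1] Lnorm_kstar_diff_le[OF _ L1 _ L1 n] return bind
    by auto
qed

end
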